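(* For every integer $k\ge 2$, the following hold. (i) There exists a graph $G_k$ such that $\eta(G_k)=1$ and $\eta_\ell(G_k)\ge k$. (ii) There exists a regular graph $H_k$ such that $\eta(H_k)=2$ and $\eta_\ell(H_k)\ge k$.
   Context: All graphs are finite and simple. $\mathbb N$ denotes the positive integers and $[k]=\{1,2,\ldots,k\}$. For a graph $G$ and a labeling $\ell:V(G)\to\mathbb N$, put $S_\ell(v)=\sum_{w\in N(v)}\ell(w)$, where $N(v)$ is the open neighborhood of $v$. The labeling $\ell$ is an additive labeling if $S_\ell(u)\ne S_\ell(v)$ for every edge $uv\in E(G)$. The additive number $\eta(G)$ is the least positive integer $k$ such that $G$ has an additive labeling $\ell:V(G)\to[k]$. The list additive number $\eta_\ell(G)$ is the least positive integer $k$ such that for every assignment of $k$-element lists $L(v)\subset\mathbb N$ to the vertices $v\in V(G)$ there is an additive labeling $\ell$ of $G$ with $\ell(v)\in L(v)$ for every vertex $v$. (The subscript in $\eta_\ell(G)$ is only notation and does not refer to a particular labeling.) *)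

theory Defs
  imports "Graph_Theory.Pair_Digraph"
begin

text \<open>A finite simple graph is a \<open>pair_graph\<close>: finite vertex set, irreflexive symmetric arc
  relation, so that an edge \<open>uv\<close> is the pair of arcs \<open>(u, v)\<close>, \<open>(v, u)\<close>.\<close>

definition open_nbhd :: "'a pair_pre_digraph \<Rightarrow> 'a \<Rightarrow> 'a set" where
  "open_nbhd G v = {w. (v, w) \<in> parcs G}"

definition regular_graph :: "'a pair_pre_digraph \<Rightarrow> bool" where
  "regular_graph G \<longleftrightarrow> (\<exists>d. \<forall>v\<in>pverts G. out_degree (with_proj G) v = d)"

text \<open>Labelings are total functions; only their values on \<open>pverts G\<close> matter.\<close>

definition nbr_sum :: "'a pair_pre_digraph \<Rightarrow> ('a \<Rightarrow> nat) \<Rightarrow> 'a \<Rightarrow> nat" where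
  "nbr_sum G l v = (\<Sum>w\<in>open_nbhd G v. l w)"

definition additive_labeling :: "'a pair_pre_digraph \<Rightarrow> ('a \<Rightarrow> nat) \<Rightarrow> bool" where
  "additive_labeling G l \<longleftrightarrow>
     (\<forall>v\<in>pverts G. l v > 0) \<and> (\<forall>(u, v)\<in>parcs G. nbr_sum G l u \<noteq> nbr_sum G l v)"

definition additive_colorable :: "'a pair_pre_digraph \<Rightarrow> nat \<Rightarrow> bool" where
  "additive_colorable G k \<longleftrightarrow> (\<exists>l. additive_labeling G l \<and> (\<forall>v\<in>pverts G. l v \<in> {1..k}))"

definition additive_choosable :: "'a pair_pre_digraph \<Rightarrow> nat \<Rightarrow> bool" where
  "additive_choosable G k \<longleftrightarrow>
     (\<forall>L :: 'a \<Rightarrow> nat set. (\<forall>v\<in>pverts G. L v \<subseteq> {1..} \<and> finite (L v) \<and> card (L v) = k) \<longrightarrow>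
        (\<exists>l. additive_labeling G l \<and> (\<forall>v\<in>pverts G. l v \<in> L v)))"

definition additive_number :: "'a pair_pre_digraph \<Rightarrow> nat" where
  "additive_number G = (LEAST k. k > 0 \<and> additive_colorable G k)"

definition list_additive_number :: "'a pair_pre_digraph \<Rightarrow> nat" where
  "list_additive_number G = (LEAST k. k > 0 \<and> additive_choosable G k)"

text \<open>Both minima range over nonempty sets: choose the labels one vertex at a time. For an edge
  \<open>uv\<close>, the last label chosen in the (nonempty) symmetric difference of the two neighborhoods has at
  most one forbidden value, so lists with more elements than there are arcs suffice.\<close>

lemma additive_choosable_card_arcs:
  assumes "pair_graph G"
  shows "additive_choosable G (Suc (card (parcs G)))"
  unfolding additive_choosable_def
proof (intro allI impI)
  interpret pair_graph G by fact
  let ?N = "open_nbhd G"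
  fix L :: "'a \<Rightarrow> nat set"
  assume L: "\<forall>v\<in>pverts G. L v \<subseteq> {1..} \<and> finite (L v) \<and> card (L v) = Suc (card (parcs G))"
  have finN: "finite (?N v)" for v
    by (rule finite_subset[of _ "pverts G"])
      (auto simp: open_nbhd_def pair_finite_verts dest: in_arcsD2)
  have "\<exists>l. (\<forall>v\<in>W. l v \<in> L v) \<and>
      (\<forall>(u, v)\<in>parcs G. (\<exists>x\<in>W. (x \<in> ?N u) \<noteq> (x \<in> ?N v)) \<longrightarrow> nbr_sum G l u \<noteq> nbr_sum G l v)"
    if "finite W" "W \<subseteq> pverts G" for W
    using that
  proof (induction W rule: finite_induct)
    case empty
    then show ?case by simp
  next
    case (insert x F)
    then obtain l where lF: "\<forall>v\<in>F. l v \<in> L v"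
      and lS: "\<And>u v y. (u, v) \<in> parcs G \<Longrightarrow> y \<in> F \<Longrightarrow> (y \<in> ?N u) \<noteq> (y \<in> ?N v)
                 \<Longrightarrow> nbr_sum G l u \<noteq> nbr_sum G l v"
      by fast
    define R where "R u = (\<Sum>w\<in>?N u - {x}. l w)" for u
    define B where "B = (\<lambda>(u, v). if x \<in> ?N u then R v - R u else R u - R v) ` parcs G"
    have "card B \<le> card (parcs G)"
      unfolding B_def by (rule card_image_le) (rule pair_finite_arcs)
    moreover have "finite B" unfolding B_def by (intro finite_imageI pair_finite_arcs)
    moreover have "finite (L x)" "card (L x) = Suc (card (parcs G))"
      using L insert.prems by auto
    ultimately have "\<not> L x \<subseteq> B"
      by (metis card_mono le_trans not_less_eq_eq order_refl)
    then obtain c where c: "c \<in> L x" "c \<notin> B" by blast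
    define m where "m = l(x := c)"
    have Sm: "nbr_sum G m u = R u + (if x \<in> ?N u then c else 0)" for u
    proof -
      have "(\<Sum>w\<in>?N u - {x}. m w) = R u"
        unfolding R_def m_def by (rule sum.cong) auto
      moreover have "m x = c" by (simp add: m_def)
      ultimately show ?thesis
        by (cases "x \<in> ?N u") (simp_all add: nbr_sum_def sum.remove[OF finN])
    qed
    have Sl: "nbr_sum G l u = R u + (if x \<in> ?N u then l x else 0)" for u
      by (cases "x \<in> ?N u") (simp_all add: nbr_sum_def R_def sum.remove[OF finN])
    have "nbr_sum G m u \<noteq> nbr_sum G m v"
      if uv: "(u, v) \<in> parcs G" and y: "y \<in> insert x F" "(y \<in> ?N u) \<noteq> (y \<in> ?N v)" for u v y
    proof (cases "(x \<in> ?N u) = (x \<in> ?N v)")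
      case True
      with y have "y \<in> F" by auto
      from lS[OF uv this y(2)] show ?thesis using True by (simp add: Sm Sl)
    next
      case False
      have "(if x \<in> ?N u then R v - R u else R u - R v) \<in> B"
        unfolding B_def using uv by (intro image_eqI[where x = "(u, v)"]) auto
      then have "c \<noteq> (if x \<in> ?N u then R v - R u else R u - R v)"
        using c(2) by metis
      then show ?thesis using False by (auto simp: Sm split: if_splits)
    qed
    moreover have "\<forall>v\<in>insert x F. m v \<in> L v"
      using lF c(1) by (simp add: m_def)
    ultimately show ?case by (intro exI[of _ m]) blast
  qed
  from this[OF pair_finite_verts subset_refl] obtain l where
    lL: "\<forall>v\<in>pverts G. l v \<in> L v" and
    lS: "\<forall>(u, v)\<in>parcs G. (\<exists>x\<in>pverts G. (x \<in> ?N u) \<noteq> (x \<in> ?N v))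
           \<longrightarrow> nbr_sum G l u \<noteq> nbr_sum G l v"
    by blast
  have "nbr_sum G l u \<noteq> nbr_sum G l v" if "(u, v) \<in> parcs G" for u v
  proof -
    have "v \<in> ?N u" "v \<notin> ?N v" "v \<in> pverts G"
      using that pair_no_loops[of "(v, v)"] by (auto simp: open_nbhd_def dest: in_arcsD2)
    then show ?thesis using lS that by blast
  qed
  moreover have "\<forall>v\<in>pverts G. l v > 0" using lL L by fastforce
  ultimately show "\<exists>l. additive_labeling G l \<and> (\<forall>v\<in>pverts G. l v \<in> L v)"
    using lL unfolding additive_labeling_def by blast
qed

lemma additive_choosable_imp_colorable:
  "additive_choosable G k \<Longrightarrow> additive_colorable G k"
  unfolding additive_choosable_def additive_colorable_def
  by (drule spec[of _ "\<lambda>_. {1..k}"]) auto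

lemma list_additive_number:
  assumes "pair_graph G"
  shows "list_additive_number G > 0 \<and> additive_choosable G (list_additive_number G)"
  unfolding list_additive_number_def
  by (rule LeastI[of _ "Suc (card (parcs G))"]) (simp add: additive_choosable_card_arcs assms)

lemma additive_number:
  assumes "pair_graph G"
  shows "additive_number G > 0 \<and> additive_colorable G (additive_number G)"
  unfolding additive_number_def
  by (rule LeastI[of _ "Suc (card (parcs G))"])
    (simp add: additive_choosable_imp_colorable additive_choosable_card_arcs assms)

end

theory Submission
  imports Defs "HOL-Library.Countable" "HOL-Library.FuncSet"
begin

text \<open>In a clique all of whose vertices \<open>u\<^sub>0, \<dots>, u\<^sub>K\<close> have their remaining neighbors outside, the
  neighbor sum of \<open>u\<^sub>i\<close> is a constant plus \<open>e\<^sub>i - l(u\<^sub>i)\<close>, where \<open>e\<^sub>i\<close> is the external contribution.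
  If the list of \<open>u\<^sub>i\<close> is \<open>{e\<^sub>i + 1, \<dots>, e\<^sub>i + K}\<close>, then two of the \<open>K + 1\<close> neighbor sums agree by the
  pigeonhole principle. The external neighbors come from a fixed set of ``points'' with lists
  \<open>{1, \<dots>, K}\<close>, and there is one clique, with correspondingly shifted lists, for every possible
  labeling of the points; whatever labels the points receive, one of the cliques is in conflict.
  On the other hand, letting \<open>u\<^sub>i\<close> see \<open>i\<close> points makes all degrees along edges distinct. For a
  regular graph, one takes two families of points and cliques, with complementary adjacency
  between the two families, so that \<open>u\<^sub>i\<close> sees \<open>i\<close> points of one family and \<open>R - i\<close> of the other.\<close>

section \<open>Additive labelings\<close>

lemma out_degree_eq_nbr_sum: "out_degree (with_proj G) v = nbr_sum G (\<lambda>_. 1) v"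
proof -
  have "out_arcs (with_proj G) v = Pair v ` open_nbhd G v"
    by (auto simp: out_arcs_def open_nbhd_def)
  then show ?thesis
    by (simp add: out_degree_def nbr_sum_def card_image inj_on_def)
qed

text \<open>Since \<open>list_additive_number\<close> is a minimum, failure at \<open>k\<close> must
  be carried down to every smaller size; passing to \<open>j\<close>-element sublists does
  this.\<close>

lemma additive_choosable_mono:
  assumes "additive_choosable G j" "j \<le> k"
  shows "additive_choosable G k"
  unfolding additive_choosable_def
proof (intro allI impI)
  fix L :: "'a \<Rightarrow> nat set"
  assume L: "\<forall>v\<in>pverts G. L v \<subseteq> {1..} \<and> finite (L v) \<and> card (L v) = k"
  have "\<forall>v\<in>pverts G. \<exists>T. T \<subseteq> L v \<and> card T = j \<and> finite T"
    using L assms(2) by (metis obtain_subset_with_card_n)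
  then obtain T where T: "\<forall>v\<in>pverts G. T v \<subseteq> L v \<and> card (T v) = j \<and> finite (T v)"
    by metis
  then have "\<forall>v\<in>pverts G. T v \<subseteq> {1..} \<and> finite (T v) \<and> card (T v) = j"
    using L by blast
  then obtain l where "additive_labeling G l" "\<forall>v\<in>pverts G. l v \<in> T v"
    using assms(1) unfolding additive_choosable_def by blast
  then show "\<exists>l. additive_labeling G l \<and> (\<forall>v\<in>pverts G. l v \<in> L v)"
    using T by blast
qed

lemma list_additive_number_gt:
  assumes "pair_graph G" "\<not> additive_choosable G k"
  shows "list_additive_number G > k"
  using assms additive_choosable_mono list_additive_number[of G] not_le by blast

lemma additive_number_eq_1:
  "additive_colorable G 1 \<Longrightarrow> additive_number G = 1"
  unfolding additive_number_def by (rule Least_equality) auto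

text \<open>With all labels 1 the neighbor sums are the degrees, so in a regular graph the ends of
  any edge tie.\<close>

lemma additive_number_regular:
  assumes "pair_graph G" "regular_graph G" "parcs G \<noteq> {}" "additive_colorable G 2"
  shows "additive_number G = 2"
  unfolding additive_number_def
proof (rule Least_equality)
  interpret pair_graph G by fact
  have "\<not> additive_colorable G 1"
  proof
    assume "additive_colorable G 1"
    then obtain l where l: "additive_labeling G l" "\<forall>v\<in>pverts G. l v = 1"
      unfolding additive_colorable_def by auto
    obtain u v where uv: "(u, v) \<in> parcs G" using assms(3) by auto
    have "nbr_sum G l w = nbr_sum G (\<lambda>_. 1) w" for w
      unfolding nbr_sum_def
      by (rule sum.cong) (use l(2) in \<open>auto simp: open_nbhd_def dest: in_arcsD2\<close>)
    moreover have "nbr_sum G (\<lambda>_. 1) u = nbr_sum G (\<lambda>_. 1) v"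
      using assms(2) in_arcsD1[OF uv] in_arcsD2[OF uv]
      unfolding regular_graph_def out_degree_eq_nbr_sum by metis
    ultimately show False
      using l(1) uv unfolding additive_labeling_def by fastforce
  qed
  then show "2 \<le> k" if "k > 0 \<and> additive_colorable G k" for k
    using that by (cases "k = 1") auto
qed (use assms(4) in simp)

section \<open>Relabeling the vertices\<close>

text \<open>Transports the construction from a datatype of vertices to the natural numbers.\<close>

definition map_graph :: "('a \<Rightarrow> 'b) \<Rightarrow> 'a pair_pre_digraph \<Rightarrow> 'b pair_pre_digraph" where
  "map_graph h G = \<lparr> pverts = h ` pverts G, parcs = map_prod h h ` parcs G \<rparr>"

lemma pverts_map_graph: "pverts (map_graph h G) = h ` pverts G"
  and parcs_map_graph: "parcs (map_graph h G) = map_prod h h ` parcs G"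
  by (simp_all add: map_graph_def)

lemma pair_graph_map_graph:
  assumes "pair_graph G" "inj h"
  shows "pair_graph (map_graph h G)"
proof -
  interpret pair_graph G by fact
  show ?thesis
  proof
    show "symmetric (map_graph h G)"
      using sym_arcs[unfolded symmetric_def]
      by (auto simp: symmetric_def parcs_map_graph sym_def)
  qed (use in_arcsD1 in_arcsD2 pair_no_loops injD[OF assms(2)] in
    \<open>fastforce simp: pverts_map_graph parcs_map_graph pair_finite_verts pair_finite_arcs\<close>)+
qed

lemma nbr_sum_map_graph:
  assumes "inj h"
  shows "nbr_sum (map_graph h G) l (h v) = nbr_sum G (l \<circ> h) v"
proof -
  have "open_nbhd (map_graph h G) (h v) = h ` open_nbhd G v"
    using injD[OF assms] by (auto simp: open_nbhd_def parcs_map_graph)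
  then show ?thesis
    by (simp add: nbr_sum_def sum.reindex inj_on_subset[OF assms])
qed

lemma additive_labeling_map_graph:
  assumes "inj h"
  shows "additive_labeling (map_graph h G) l \<longleftrightarrow> additive_labeling G (l \<circ> h)"
  by (auto simp: additive_labeling_def pverts_map_graph parcs_map_graph nbr_sum_map_graph[OF assms]
      split_beta)

lemma regular_graph_map_graph:
  assumes "inj h"
  shows "regular_graph (map_graph h G) \<longleftrightarrow> regular_graph G"
  by (simp add: regular_graph_def out_degree_eq_nbr_sum pverts_map_graph
      nbr_sum_map_graph[OF assms] comp_def)

lemma additive_colorable_map_graph:
  assumes "inj h" "additive_colorable G k"
  shows "additive_colorable (map_graph h G) k"
proof -
  obtain l where l: "additive_labeling G l" "\<forall>v\<in>pverts G. l v \<in> {1..k}"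
    using assms(2) unfolding additive_colorable_def by blast
  have "(l \<circ> inv h) \<circ> h = l" using assms(1) by (simp add: comp_assoc)
  then show ?thesis
    unfolding additive_colorable_def additive_labeling_map_graph[OF assms(1)]
    using l assms(1) by (intro exI[of _ "l \<circ> inv h"]) (auto simp: pverts_map_graph)
qed

lemma additive_choosable_of_map_graph:
  assumes "inj h" "additive_choosable (map_graph h G) k"
  shows "additive_choosable G k"
  unfolding additive_choosable_def
proof (intro allI impI)
  fix L :: "'a \<Rightarrow> nat set"
  assume L: "\<forall>v\<in>pverts G. L v \<subseteq> {1..} \<and> finite (L v) \<and> card (L v) = k"
  then have "\<forall>v\<in>pverts (map_graph h G). L (inv h v) \<subseteq> {1..} \<and> finite (L (inv h v)) \<and>
      card (L (inv h v)) = k"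
    using assms(1) by (simp add: pverts_map_graph)
  then have "\<exists>l. additive_labeling (map_graph h G) l \<and> (\<forall>v\<in>pverts (map_graph h G). l v \<in> L (inv h v))"
    by (rule assms(2)[unfolded additive_choosable_def, THEN spec, THEN mp])
  then obtain l where
    "additive_labeling (map_graph h G) l" "\<forall>v\<in>pverts (map_graph h G). l v \<in> L (inv h v)"
    by blast
  then show "\<exists>l. additive_labeling G l \<and> (\<forall>v\<in>pverts G. l v \<in> L v)"
    using assms(1) additive_labeling_map_graph[OF assms(1)]
    by (intro exI[of _ "l \<circ> h"]) (auto simp: pverts_map_graph)
qed

section \<open>The clique graph\<close>

text \<open>The boolean is the family; \<open>Clique b m i\<close> is the vertex of index
  \<open>i\<close> in the clique number \<open>m\<close> of family \<open>b\<close>.\<close>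

datatype vertex = Point bool nat | Clique bool nat nat

instance vertex :: countable
  by countable_datatype

fun adj :: "vertex \<Rightarrow> vertex \<Rightarrow> bool" where
  "adj (Point c j) (Point c' j') \<longleftrightarrow> False"
| "adj (Point c j) (Clique b m i) \<longleftrightarrow> (b = c) = (j < i)"
| "adj (Clique b m i) (Point c j) \<longleftrightarrow> (b = c) = (j < i)"
| "adj (Clique b m i) (Clique b' m' i') \<longleftrightarrow> b = b' \<and> m = m' \<and> i \<noteq> i'"

text \<open>\<open>B\<close> selects the families: one for part (i), both for the regular graph.
  Each has \<open>R\<close> points and \<open>M\<close> cliques of size
  \<open>K + 1\<close>.\<close>

definition clique_graph :: "bool set \<Rightarrow> nat \<Rightarrow> nat \<Rightarrow> nat \<Rightarrow> vertex pair_pre_digraph" where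
  "clique_graph B K M R =
     (let V = (\<lambda>(c, j). Point c j) ` (B \<times> {..<R}) \<union>
              (\<lambda>(b, m, i). Clique b m i) ` (B \<times> {..<M} \<times> {..K})
      in \<lparr> pverts = V, parcs = {(u, v). u \<in> V \<and> v \<in> V \<and> adj u v} \<rparr>)"

lemma adj_sym: "adj u v \<Longrightarrow> adj v u"
  by (cases u; cases v) auto

lemma adj_irrefl: "\<not> adj u u"
  by (cases u) auto

lemma Point_in_clique_graph [simp]:
  "Point c j \<in> pverts (clique_graph B K M R) \<longleftrightarrow> c \<in> B \<and> j < R"
  by (force simp: clique_graph_def Let_def)

lemma Clique_in_clique_graph [simp]:
  "Clique b m i \<in> pverts (clique_graph B K M R) \<longleftrightarrow> b \<in> B \<and> m < M \<and> i \<le> K"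
  by (force simp: clique_graph_def Let_def)

lemma parcs_clique_graph:
  "(u, v) \<in> parcs (clique_graph B K M R) \<longleftrightarrow>
     u \<in> pverts (clique_graph B K M R) \<and> v \<in> pverts (clique_graph B K M R) \<and> adj u v"
  by (simp add: clique_graph_def Let_def)

lemma finite_pverts_clique_graph: "finite (pverts (clique_graph B K M R))"
  by (auto simp: clique_graph_def Let_def)

lemma pair_graph_clique_graph: "pair_graph (clique_graph B K M R)" (is "pair_graph ?G")
proof
  show "finite (parcs ?G)"
    by (rule finite_subset[of _ "pverts ?G \<times> pverts ?G"])
      (auto simp: parcs_clique_graph finite_pverts_clique_graph)
  show "symmetric ?G"
    by (auto simp: symmetric_def sym_def parcs_clique_graph adj_sym)
qed (auto simp: parcs_clique_graph finite_pverts_clique_graph adj_irrefl)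

lemma nbr_sum_Clique:
  assumes "b \<in> B" "m < M" "i \<le> K" "K \<le> R"
  shows "nbr_sum (clique_graph B K M R) l (Clique b m i) =
    (\<Sum>i'\<in>{..K} - {i}. l (Clique b m i')) + (\<Sum>j<i. l (Point b j)) +
    (if (\<not> b) \<in> B then \<Sum>j\<in>{i..<R}. l (Point (\<not> b) j) else 0)"
proof -
  let ?A = "Clique b m ` ({..K} - {i})" and ?P = "Point b ` {..<i}"
    and ?Q = "if (\<not> b) \<in> B then Point (\<not> b) ` {i..<R} else {}"
  have "open_nbhd (clique_graph B K M R) (Clique b m i) = ?A \<union> ?P \<union> ?Q"
  proof (rule set_eqI)
    fix v show "v \<in> open_nbhd (clique_graph B K M R) (Clique b m i) \<longleftrightarrow> v \<in> ?A \<union> ?P \<union> ?Q"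
    proof (cases v)
      case (Point c j)
      with assms show ?thesis
        by (cases b; cases c) (auto simp: open_nbhd_def parcs_clique_graph)
    qed (use assms in \<open>auto simp: open_nbhd_def parcs_clique_graph\<close>)
  qed
  moreover have "sum l (?A \<union> ?P \<union> ?Q) = sum l ?A + sum l ?P + sum l ?Q"
    by (subst sum.union_disjoint; (subst sum.union_disjoint)?) auto
  ultimately show ?thesis
    by (simp add: nbr_sum_def sum.reindex inj_on_def)
qed

lemma nbr_sum_Point:
  assumes "c \<in> B" "j < R"
  shows "nbr_sum (clique_graph B K M R) l (Point c j) =
    (\<Sum>m<M. \<Sum>i\<in>{Suc j..K}. l (Clique c m i)) +
    (if (\<not> c) \<in> B then \<Sum>m<M. \<Sum>i\<le>min j K. l (Clique (\<not> c) m i) else 0)"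
proof -
  let ?P = "(\<lambda>(m, i). Clique c m i) ` ({..<M} \<times> {Suc j..K})"
    and ?Q = "if (\<not> c) \<in> B then (\<lambda>(m, i). Clique (\<not> c) m i) ` ({..<M} \<times> {..min j K}) else {}"
  have "open_nbhd (clique_graph B K M R) (Point c j) = ?P \<union> ?Q"
  proof (rule set_eqI)
    fix v show "v \<in> open_nbhd (clique_graph B K M R) (Point c j) \<longleftrightarrow> v \<in> ?P \<union> ?Q"
    proof (cases v)
      case (Clique b m i)
      with assms show ?thesis
        by (cases b; cases c) (auto simp: open_nbhd_def parcs_clique_graph image_iff)
    qed (auto simp: open_nbhd_def parcs_clique_graph)
  qed
  moreover have "sum l (?P \<union> ?Q) = sum l ?P + sum l ?Q"
    by (subst sum.union_disjoint) auto
  ultimately show ?thesis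
    by (simp add: nbr_sum_def sum.reindex inj_on_def split_beta sum.cartesian_product)
qed

section \<open>Bad lists\<close>

text \<open>The points \<open>Point c j\<close> with \<open>j \<ge> K\<close> are adjacent to all vertices of a clique or to none,
  so they do not affect the differences of neighbor sums within it, and \<open>f\<close> may ignore them.\<close>

lemma not_additive_choosable_clique_graph:
  assumes "B \<noteq> {}" "K \<le> R"
    and f: "\<And>g. g \<in> B \<times> {..<K} \<rightarrow>\<^sub>E {1..K} \<Longrightarrow> \<exists>m<M. f m = g"
  shows "\<not> additive_choosable (clique_graph B K M R) K"
proof
  let ?G = "clique_graph B K M R"
  assume "additive_choosable ?G K"
  \<comment> \<open>\<open>f m\<close> is the guess of clique \<open>m\<close> for the labels of the
    points below \<open>K\<close>, and \<open>e b m i\<close> the external contribution it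
    predicts.\<close>
  define e where "e b m i = (\<Sum>j<i. f m (b, j)) +
    (if (\<not> b) \<in> B then \<Sum>j\<in>{i..<K}. f m (\<not> b, j) else 0)" for b m i
  define L where "L v = (case v of Point c j \<Rightarrow> {1..K} | Clique b m i \<Rightarrow> {e b m i + 1..e b m i + K})"
    for v
  have "\<forall>v\<in>pverts ?G. L v \<subseteq> {1..} \<and> finite (L v) \<and> card (L v) = K"
    by (auto simp: L_def split: vertex.split)
  then have "\<exists>l. additive_labeling ?G l \<and> (\<forall>v\<in>pverts ?G. l v \<in> L v)"
    by (rule \<open>additive_choosable ?G K\<close>[unfolded additive_choosable_def, THEN spec, THEN mp])
  then obtain l where l: "additive_labeling ?G l" and lL: "\<And>v. v \<in> pverts ?G \<Longrightarrow> l v \<in> L v"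
    by blast
  \<comment> \<open>The actual labels of these points are one of the guesses, so some clique
    \<open>m\<close> predicts correctly.\<close>
  have "(\<lambda>(c, j)\<in>B \<times> {..<K}. l (Point c j)) \<in> B \<times> {..<K} \<rightarrow>\<^sub>E {1..K}"
    using lL[of "Point _ _"] assms(2) by (force simp: L_def)
  from f[OF this] obtain m where m: "m < M"
    and fm: "\<And>c j. c \<in> B \<Longrightarrow> j < K \<Longrightarrow> f m (c, j) = l (Point c j)"
    by fastforce
  obtain b where b: "b \<in> B" using assms(1) by blast
  define t where "t i = l (Clique b m i) - e b m i" for i
  have t: "t i \<in> {1..K}" "l (Clique b m i) = e b m i + t i" if "i \<le> K" for i
    using lL[of "Clique b m i"] b m that by (auto simp: L_def t_def)
  \<comment> \<open>The correctly predicted contribution cancels against the shift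
    \<open>e b m i\<close>, leaving a value independent of \<open>i\<close>.\<close>
  define C where "C = (\<Sum>i\<le>K. l (Clique b m i)) +
    (if (\<not> b) \<in> B then \<Sum>j\<in>{K..<R}. l (Point (\<not> b) j) else 0)"
  have S: "nbr_sum ?G l (Clique b m i) + t i = C" if "i \<le> K" for i
  proof -
    have "(\<Sum>i'\<le>K. l (Clique b m i')) = l (Clique b m i) + (\<Sum>i'\<in>{..K} - {i}. l (Clique b m i'))"
      using that by (simp add: sum.remove)
    moreover have "(\<Sum>j\<in>{i..<R}. l (Point (\<not> b) j)) =
        (\<Sum>j\<in>{i..<K}. l (Point (\<not> b) j)) + (\<Sum>j\<in>{K..<R}. l (Point (\<not> b) j))"
      using that assms(2) by (simp add: sum.atLeastLessThan_concat)
    moreover have "(\<Sum>j<i. f m (b, j)) = (\<Sum>j<i. l (Point b j))"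
      using that b by (intro sum.cong) (auto simp: fm)
    moreover have "(\<Sum>j\<in>{i..<K}. f m (\<not> b, j)) = (\<Sum>j\<in>{i..<K}. l (Point (\<not> b) j))"
      if "(\<not> b) \<in> B"
      using that by (intro sum.cong) (auto simp: fm)
    ultimately show ?thesis
      using t(2)[OF that] nbr_sum_Clique[OF b m that assms(2), of l] by (simp add: C_def e_def)
  qed
  have "\<not> inj_on t {..K}"
  proof
    assume "inj_on t {..K}"
    moreover have "t ` {..K} \<subseteq> {1..K}" using t(1) by blast
    ultimately show False using card_inj_on_le[of t "{..K}" "{1..K}"] by simp
  qed
  then obtain i i' where i: "i \<le> K" "i' \<le> K" "i \<noteq> i'" "t i = t i'"
    by (auto simp: inj_on_def)
  then have "nbr_sum ?G l (Clique b m i) = nbr_sum ?G l (Clique b m i')"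
    using S[of i] S[of i'] by simp
  moreover have "(Clique b m i, Clique b m i') \<in> parcs ?G"
    using b m i by (simp add: parcs_clique_graph)
  ultimately show False using l unfolding additive_labeling_def by fastforce
qed

text \<open>The finitely many guesses are enumerated by clique numbers, and surplus cliques are
  harmless. As guesses ignore the points from \<open>K\<close> on, \<open>M\<close> is chosen before
  \<open>R\<close>, so \<open>R\<close> may later depend on \<open>M\<close>.\<close>

lemma ex_not_additive_choosable_clique_graph:
  assumes "B \<noteq> {}"
  obtains M where "M > N" "\<And>R. K \<le> R \<Longrightarrow> \<not> additive_choosable (clique_graph B K M R) K"
proof -
  let ?F = "B \<times> {..<K} \<rightarrow>\<^sub>E {1..K}"
  have "finite ?F" by (intro finite_PiE finite_cartesian_product) auto
  from finite_imp_nat_seg_image_inj_on[OF this]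
  obtain n :: nat and f where f: "?F = f ` {i. i < n}" by blast
  show ?thesis
  proof (rule that[of "n + N + 1"])
    fix R assume R: "K \<le> R"
    show "\<not> additive_choosable (clique_graph B K (n + N + 1) R) K"
    proof (rule not_additive_choosable_clique_graph[OF assms R, of _ f])
      fix g assume "g \<in> ?F"
      then obtain m where "m < n" "f m = g"
        unfolding f by blast
      then show "\<exists>m<n + N + 1. f m = g" by (intro exI[of _ m]) simp
    qed
  qed simp
qed

section \<open>Labelings with one or two labels\<close>

text \<open>Points are pairwise nonadjacent; for edges between cliques and points it suffices that
  the points have the larger sums.\<close>

lemma additive_labeling_clique_graphI:
  assumes pos: "\<And>v. v \<in> pverts (clique_graph B K M R) \<Longrightarrow> l v > 0"
    and clique: "\<And>b m i i'. b \<in> B \<Longrightarrow> m < M \<Longrightarrow> i < i' \<Longrightarrow> i' \<le> K \<Longrightarrow>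
      nbr_sum (clique_graph B K M R) l (Clique b m i) \<noteq>
      nbr_sum (clique_graph B K M R) l (Clique b m i')"
    and point: "\<And>b c m i j. b \<in> B \<Longrightarrow> c \<in> B \<Longrightarrow> m < M \<Longrightarrow> i \<le> K \<Longrightarrow> j < R \<Longrightarrow> (b = c) = (j < i) \<Longrightarrow>
      nbr_sum (clique_graph B K M R) l (Clique b m i) <
      nbr_sum (clique_graph B K M R) l (Point c j)"
  shows "additive_labeling (clique_graph B K M R) l"
proof -
  let ?S = "nbr_sum (clique_graph B K M R) l"
  have "?S u \<noteq> ?S v" if uv: "(u, v) \<in> parcs (clique_graph B K M R)" for u v
  proof (cases u)
    case u: (Point c j)
    obtain b m i where v: "v = Clique b m i"
      using uv by (cases v) (auto simp: u parcs_clique_graph)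
    show ?thesis using uv point[of b c m i j] by (auto simp: u v parcs_clique_graph)
  next
    case u: (Clique b m i)
    show ?thesis
    proof (cases v)
      case v: (Point c j)
      show ?thesis using uv point[of b c m i j] by (auto simp: u v parcs_clique_graph)
    next
      case v: (Clique b' m' i')
      show ?thesis
        using uv clique[of b m i i'] clique[of b m i' i]
        by (cases i i' rule: linorder_cases) (auto simp: u v parcs_clique_graph)
    qed
  qed
  then show ?thesis using pos by (auto simp: additive_labeling_def)
qed

text \<open>Clique vertices have the distinct degrees \<open>K + i\<close>, at most
  \<open>2 * K\<close>, while each point sees at least one vertex in each of the \<open>M\<close>
  cliques.\<close>

lemma additive_colorable_1_clique_graph:
  assumes "M > 2 * K"
  shows "additive_colorable (clique_graph {True} K M K) 1"
proof -
  let ?G = "clique_graph {True} K M K"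
  have C: "nbr_sum ?G (\<lambda>_. 1) (Clique True m i) = K + i" if "m < M" "i \<le> K" for m i
    using that by (simp add: nbr_sum_Clique)
  have "additive_labeling ?G (\<lambda>_. 1)"
  proof (rule additive_labeling_clique_graphI)
    fix b c m i j assume *: "b \<in> {True}" "c \<in> {True}" "m < M" "i \<le> K" "j < K"
    have "K + i \<le> 2 * K" using *(4) by simp
    also note assms
    also have "M \<le> M * (K - j)" using *(5) by (cases "K - j") simp_all
    also have "\<dots> = nbr_sum ?G (\<lambda>_. 1) (Point c j)"
      using * by (simp add: nbr_sum_Point)
    finally show "nbr_sum ?G (\<lambda>_. 1) (Clique b m i) < nbr_sum ?G (\<lambda>_. 1) (Point c j)"
      using * C by simp
  qed (use C in auto)
  then show ?thesis unfolding additive_colorable_def by auto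
qed

text \<open>Choosing \<open>R\<close> with \<open>R + K = M * (K + 1)\<close> equates the degree \<open>R + K\<close> of the clique vertices with
  the degree of the points.\<close>

lemma regular_clique_graph:
  assumes "R + K = M * (K + 1)" "K \<le> R"
  shows "regular_graph (clique_graph UNIV K M R)"
  unfolding regular_graph_def out_degree_eq_nbr_sum
proof (intro exI ballI)
  fix v assume v: "v \<in> pverts (clique_graph UNIV K M R)"
  show "nbr_sum (clique_graph UNIV K M R) (\<lambda>_. 1) v = R + K"
  proof (cases v)
    case (Point c j)
    \<comment> \<open>The neighbors of a point in one clique of its own family and in one of the
      other family.\<close>
    have "(K - j) + (min j K + 1) = K + 1" by simp
    then have "M * (K - j) + M * (min j K + 1) = M * (K + 1)"
      by (simp only: flip: distrib_left)
    with Point v assms(1) show ?thesis by (simp add: nbr_sum_Point)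
  qed (use v assms in \<open>simp add: nbr_sum_Clique\<close>)
qed

text \<open>Breaking the symmetry between the families makes the sums increase with \<open>i\<close>
  in \<open>True\<close> cliques and decrease in \<open>False\<close> cliques. They stay at most
  \<open>3 * K + R\<close>, below the point sums \<open>2 * (R + K)\<close>.\<close>

lemma additive_colorable_2_clique_graph:
  assumes "R + K = M * (K + 1)" "K < R"
  shows "additive_colorable (clique_graph UNIV K M R) 2"
proof -
  let ?G = "clique_graph UNIV K M R"
  \<comment> \<open>If all points of family \<open>True\<close> had label 2, the vertex of index 0
    in a \<open>False\<close> clique would see only 2s and tie with its point neighbors.\<close>
  define l :: "vertex \<Rightarrow> nat"
    where "l v = (case v of Clique _ _ _ \<Rightarrow> 2 | Point c j \<Rightarrow> if c \<and> j < K then 2 else 1)"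
    for v
  have C: "nbr_sum ?G l (Clique b m i) = (if b then 2 * K + R + i else 3 * K + R - i)"
    if "m < M" "i \<le> K" for b m i
  proof (cases b)
    case True
    with that assms(2) show ?thesis by (simp add: nbr_sum_Clique l_def)
  next
    case False
    have "(\<Sum>j\<in>{i..<R}. l (Point True j)) =
        (\<Sum>j\<in>{i..<K}. l (Point True j)) + (\<Sum>j\<in>{K..<R}. l (Point True j))"
      using that assms(2) by (simp add: sum.atLeastLessThan_concat)
    also have "\<dots> = 2 * (K - i) + (R - K)" by (simp add: l_def)
    finally show ?thesis
      using False that assms(2) by (simp add: nbr_sum_Clique) (simp add: l_def)
  qed
  have P: "nbr_sum ?G l (Point c j) = 2 * (R + K)" if "j < R" for c j
  proof -
    have "(K - j) + (min j K + 1) = K + 1" by simp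
    then have "M * (K - j) + M * (min j K + 1) = M * (K + 1)"
      by (simp only: flip: distrib_left)
    with that assms(1) show ?thesis by (simp add: nbr_sum_Point l_def)
  qed
  have "additive_labeling ?G l"
    by (rule additive_labeling_clique_graphI)
      (use assms(2) in \<open>auto simp: C P l_def split: vertex.split\<close>)
  then show ?thesis
    unfolding additive_colorable_def by (auto simp: l_def split: vertex.split)
qed

theorem theorem1:
  fixes k :: nat
  assumes "k \<ge> 2"
  shows "(\<exists>G :: nat pair_pre_digraph. pair_graph G \<and>
            additive_number G = 1 \<and> list_additive_number G \<ge> k) \<and>
         (\<exists>H :: nat pair_pre_digraph. pair_graph H \<and> regular_graph H \<and>
            additive_number H = 2 \<and> list_additive_number H \<ge> k)"
proof
  define h :: "vertex \<Rightarrow> nat" where "h = to_nat"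
  have h: "inj h" by (simp add: h_def)
  obtain M where M: "M > 2 * k" "\<not> additive_choosable (clique_graph {True} k M k) k"
    using ex_not_additive_choosable_clique_graph[of "{True}" "2 * k" k] by blast
  let ?G = "map_graph h (clique_graph {True} k M k)"
  have G: "pair_graph ?G" by (rule pair_graph_map_graph[OF pair_graph_clique_graph h])
  have "additive_number ?G = 1"
    by (intro additive_number_eq_1 additive_colorable_map_graph[OF h]
        additive_colorable_1_clique_graph M(1))
  moreover have "list_additive_number ?G > k"
    using list_additive_number_gt[OF G] additive_choosable_of_map_graph[OF h] M(2) by blast
  ultimately show "\<exists>G :: nat pair_pre_digraph. pair_graph G \<and>
      additive_number G = 1 \<and> list_additive_number G \<ge> k"
    using G by (intro exI[of _ ?G]) simp
next
  define h :: "vertex \<Rightarrow> nat" where "h = to_nat"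
  have h: "inj h" by (simp add: h_def)
  obtain M where M: "M > 2 * k"
    and nch: "\<And>R. k \<le> R \<Longrightarrow> \<not> additive_choosable (clique_graph UNIV k M R) k"
    using ex_not_additive_choosable_clique_graph[of UNIV "2 * k" k] by blast
  define R where "R = M * (k + 1) - k"
  \<comment> \<open>With \<open>M > 2 * k\<close> this keeps the subtraction in \<open>R\<close>
    from truncating and gives \<open>k < R\<close>.\<close>
  have "M \<le> M * (k + 1)" by simp
  then have R: "R + k = M * (k + 1)" "k < R"
    using M by (simp_all only: R_def)
  let ?H = "map_graph h (clique_graph UNIV k M R)"
  have H: "pair_graph ?H" by (rule pair_graph_map_graph[OF pair_graph_clique_graph h])
  have reg: "regular_graph ?H"
    using regular_clique_graph R h by (simp add: regular_graph_map_graph)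
  have "(Clique True 0 0, Clique True 0 1) \<in> parcs (clique_graph UNIV k M R)"
    using M assms by (simp add: parcs_clique_graph)
  then have "parcs ?H \<noteq> {}" by (auto simp: parcs_map_graph)
  then have "additive_number ?H = 2"
    by (intro additive_number_regular H reg additive_colorable_map_graph[OF h]
        additive_colorable_2_clique_graph R)
  moreover have "list_additive_number ?H > k"
    using list_additive_number_gt[OF H] additive_choosable_of_map_graph[OF h] nch R(2) by fastforce
  ultimately show "\<exists>H :: nat pair_pre_digraph. pair_graph H \<and> regular_graph H \<and>
      additive_number H = 2 \<and> list_additive_number H \<ge> k"
    using H reg by (intro exI[of _ ?H]) simp
qed

end
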